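(* Let $\mathcal{M}$ be a map of valence $q$, let $1\le j<\frac q2$, let $L$ be a transitive $j$-corneration of $\mathcal{M}$, and let $v$ be a vertex of $\mathcal{M}$. Then one of the following holds: (i) $j$ is odd and $L_v$ is equivalent to the standard odd local corneration; or (ii) $j\equiv 2 \pmod 4$, $L_v$ is equivalent to the standard even local corneration, and the local action of $\mathrm{Aut}(L)$ is of type QD.
   Context: Graphs are finite, may have parallel edges, and have no loops or semi-edges. A map $\mathcal{M}$ is an embedding of a graph (its skeleton) into a connected compact surface without boundary such that all components of the complement (the faces) are open disks. It has valence $q$ if every vertex is incident with $q$ edges. A symmetry of $\mathcal{M}$ is an automorphism of the skeleton induced by a homeomorphism of the surface; $\mathrm{Aut}(\mathcal{M})$ is the group of symmetries. It acts faithfully and semiregularly on the flags (triangles of the barycentric subdivision) of $\mathcal{M}$, and is the group of flag permutations preserving each kind of flag adjacency. A dart is an incident vertex-edge pair. A corner is a set $\{e_1,v,e_2\}$ with $e_1\neq e_2$ edges incident to the vertex $v$; it contains the darts $\{e_1,v\}$ and $\{e_2,v\}$. If the edges at $v$ are numbered consecutively around $v$ by $0,1,\dots,q-1\in\mathbb{Z}_q$, a corner is a $j$-corner if its two edges have labels differing by $\pm j$ modulo $q$. A corneration is a set $L$ of corners such that every dart is contained in exactly one corner of $L$; it is a $j$-corneration if all its corners are $j$-corners. $\mathrm{Aut}(L)$ is the group of all symmetries of $\mathcal{M}$ preserving $L$; $L$ is transitive if $\mathrm{Aut}(L)$ is transitive on $L$. $L_v$ denotes the set of corners of $L$ containing $v$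 (the local corneration at $v$). Relative to a consecutive numbering of the edges at $v$ by $\mathbb{Z}_q$, let $c_i$ denote the $j$-corner at $v$ with edges $i$ and $i+j$. The standard odd local corneration (for $j$ odd, $q$ even) is $\{c_{2i}\mid i\in\{0,\dots,\frac q2-1\}\}$. The standard even local corneration (for $j\equiv2\pmod 4$ and $4\mid q$) is $\{c_i\mid i \bmod 4\in\{0,3\}\}$. There are $2q$ consecutive numberings at $v$ (choice of starting edge and direction), all considered equivalent; $L_v$ is equivalent to a standard local corneration if it equals it for some choice of consecutive numbering. The local action of $G=\mathrm{Aut}(L)$ is of type QD if $4\mid q$ and, for a suitable consecutive numbering of the edges at $v$, the stabilizer $G_v$ acting on the labels in $\mathbb{Z}_q$ is the group $\langle\mu_1,\mu_5\rangle\cong D_{q/4}$ of order $q/2$, where $\mu_f: i\mapsto f-i$. *)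

theory Defs
  imports "HOL-Algebra.Bij" "HOL-Algebra.Generated_Groups" "HOL-Number_Theory.Cong"
begin

text \<open>
  A map is given by its flags (the triangles of the barycentric subdivision) and the three
  flag adjacencies: \<open>adj0\<close> changes the vertex of a flag, \<open>adj1\<close> its edge and \<open>adj2\<close> its face.
  Vertices, edges and faces are the orbits of flags under the other two adjacencies.
\<close>

record 'f flag_system =
  flags :: "'f set"
  adj0 :: "'f \<Rightarrow> 'f"
  adj1 :: "'f \<Rightarrow> 'f"
  adj2 :: "'f \<Rightarrow> 'f"

text \<open>The adjacencies are involutions, so forward reachability already gives the orbit
  of the group they generate.\<close>

definition orbit_under :: "('f \<Rightarrow> 'f) set \<Rightarrow> 'f \<Rightarrow> 'f set" where
  "orbit_under R x = {y. (x, y) \<in> {(a, r a) | a r. r \<in> R}\<^sup>*}"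

definition vertex_of :: "'f flag_system \<Rightarrow> 'f \<Rightarrow> 'f set" where
  "vertex_of M x = orbit_under {adj1 M, adj2 M} x"

definition edge_of :: "'f flag_system \<Rightarrow> 'f \<Rightarrow> 'f set" where
  "edge_of M x = orbit_under {adj0 M, adj2 M} x"

definition vertices :: "'f flag_system \<Rightarrow> 'f set set" where
  "vertices M = vertex_of M ` flags M"

definition edges :: "'f flag_system \<Rightarrow> 'f set set" where
  "edges M = edge_of M ` flags M"

text \<open>
  The adjacencies have no fixed points since the surface has no boundary; \<open>adj0 \<circ> adj2\<close> has
  none since there are no semi-edges; the surface is connected; and the last clause excludes
  loops. Parallel edges are allowed.
\<close>

definition is_map :: "'f flag_system \<Rightarrow> bool" where
  "is_map M \<longleftrightarrow>
     finite (flags M) \<and> flags M \<noteq> {} \<and>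
     (\<forall>r \<in> {adj0 M, adj1 M, adj2 M}. \<forall>x \<in> flags M.
        r x \<in> flags M \<and> r (r x) = x \<and> r x \<noteq> x) \<and>
     (\<forall>x \<in> flags M. adj0 M (adj2 M x) = adj2 M (adj0 M x) \<and> adj0 M (adj2 M x) \<noteq> x) \<and>
     (\<forall>x \<in> flags M. orbit_under {adj0 M, adj1 M, adj2 M} x = flags M) \<and>
     (\<forall>x \<in> flags M. vertex_of M (adj0 M x) \<noteq> vertex_of M x)"

definition incident :: "'f set \<Rightarrow> 'f set \<Rightarrow> bool" where
  "incident v e \<longleftrightarrow> v \<inter> e \<noteq> {}"

definition has_valence :: "'f flag_system \<Rightarrow> nat \<Rightarrow> bool" where
  "has_valence M q \<longleftrightarrow> (\<forall>v \<in> vertices M. card {e \<in> edges M. incident v e} = q)"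

definition Aut_map :: "'f flag_system \<Rightarrow> ('f \<Rightarrow> 'f) set" where
  "Aut_map M = {g \<in> Bij (flags M). \<forall>x \<in> flags M.
     g (adj0 M x) = adj0 M (g x) \<and> g (adj1 M x) = adj1 M (g x) \<and> g (adj2 M x) = adj2 M (g x)}"

text \<open>The dart \<open>{v, e}\<close> is represented by \<open>(v, e)\<close>, the corner \<open>{e1, v, e2}\<close> by
  \<open>(v, {e1, e2})\<close>.\<close>

type_synonym 'f dart = "'f set \<times> 'f set"
type_synonym 'f corner = "'f set \<times> 'f set set"

definition darts :: "'f flag_system \<Rightarrow> 'f dart set" where
  "darts M = {(v, e). v \<in> vertices M \<and> e \<in> edges M \<and> incident v e}"

definition corners :: "'f flag_system \<Rightarrow> 'f corner set" where
  "corners M = {(v, {e1, e2}) | v e1 e2.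
     (v, e1) \<in> darts M \<and> (v, e2) \<in> darts M \<and> e1 \<noteq> e2}"

definition corner_darts :: "'f corner \<Rightarrow> 'f dart set" where
  "corner_darts c = {(fst c, e) | e. e \<in> snd c}"

definition corneration :: "'f flag_system \<Rightarrow> 'f corner set \<Rightarrow> bool" where
  "corneration M L \<longleftrightarrow>
     L \<subseteq> corners M \<and> (\<forall>d \<in> darts M. \<exists>!c. c \<in> L \<and> d \<in> corner_darts c)"

text \<open>
  Labels in \<open>\<int>\<^sub>q\<close> are integers modulo \<open>q\<close>. A consecutive numbering is determined by a flag
  at \<open>v\<close>, whose edge receives label \<open>0\<close> and whose face determines the direction:
  \<open>adj2 \<circ> adj1\<close> moves across that face to the next edge at \<open>v\<close>, and then to the far side of
  that edge. At a vertex of valence \<open>q\<close> there are \<open>2 q\<close> flags, hence \<open>2 q\<close> numberings.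
\<close>

definition consecutive_numbering ::
    "'f flag_system \<Rightarrow> nat \<Rightarrow> 'f set \<Rightarrow> (int \<Rightarrow> 'f set) \<Rightarrow> bool" where
  "consecutive_numbering M q v n \<longleftrightarrow>
     (\<exists>x \<in> v. \<forall>i. n i = edge_of M (((adj2 M \<circ> adj1 M) ^^ nat (i mod int q)) x))"

definition j_corner :: "'f flag_system \<Rightarrow> nat \<Rightarrow> nat \<Rightarrow> 'f corner \<Rightarrow> bool" where
  "j_corner M q j c \<longleftrightarrow> c \<in> corners M \<and>
     (\<exists>n a b. consecutive_numbering M q (fst c) n \<and> snd c = {n a, n b} \<and>
        ([b - a = int j] (mod int q) \<or> [b - a = - int j] (mod int q)))"

definition j_corneration :: "'f flag_system \<Rightarrow> nat \<Rightarrow> nat \<Rightarrow> 'f corner set \<Rightarrow> bool" where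
  "j_corneration M q j L \<longleftrightarrow> corneration M L \<and> (\<forall>c \<in> L. j_corner M q j c)"

definition move_corner :: "('f \<Rightarrow> 'f) \<Rightarrow> 'f corner \<Rightarrow> 'f corner" where
  "move_corner g c = (g ` fst c, (\<lambda>e. g ` e) ` snd c)"

definition Aut_corneration :: "'f flag_system \<Rightarrow> 'f corner set \<Rightarrow> ('f \<Rightarrow> 'f) set" where
  "Aut_corneration M L = {g \<in> Aut_map M. move_corner g ` L = L}"

definition transitive_corneration :: "'f flag_system \<Rightarrow> 'f corner set \<Rightarrow> bool" where
  "transitive_corneration M L \<longleftrightarrow>
     (\<forall>c \<in> L. \<forall>c' \<in> L. \<exists>g \<in> Aut_corneration M L. move_corner g c = c')"

definition local_corneration :: "'f corner set \<Rightarrow> 'f set \<Rightarrow> 'f corner set" where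
  "local_corneration L v = {c \<in> L. fst c = v}"

text \<open>The \<open>j\<close>-corner \<open>c\<^sub>i\<close> relative to the numbering \<open>n\<close>.\<close>

definition numbered_corner :: "'f set \<Rightarrow> (int \<Rightarrow> 'f set) \<Rightarrow> nat \<Rightarrow> int \<Rightarrow> 'f corner" where
  "numbered_corner v n j i = (v, {n i, n (i + int j)})"

definition standard_odd :: "nat \<Rightarrow> nat \<Rightarrow> 'f set \<Rightarrow> (int \<Rightarrow> 'f set) \<Rightarrow> 'f corner set" where
  "standard_odd q j v n =
     {numbered_corner v n j (2 * i) | i. i \<in> {0 ..< int (q div 2)}}"

definition standard_even :: "nat \<Rightarrow> nat \<Rightarrow> 'f set \<Rightarrow> (int \<Rightarrow> 'f set) \<Rightarrow> 'f corner set" where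
  "standard_even q j v n =
     {numbered_corner v n j i | i. i \<in> {0 ..< int q} \<and> i mod 4 \<in> {0, 3}}"

text \<open>The standard local cornerations exist only for the stated values of \<open>q\<close> and \<open>j\<close>,
  so these conditions are part of the equivalence predicates.\<close>

definition equiv_standard_odd ::
    "'f flag_system \<Rightarrow> nat \<Rightarrow> nat \<Rightarrow> 'f set \<Rightarrow> 'f corner set \<Rightarrow> bool" where
  "equiv_standard_odd M q j v K \<longleftrightarrow> odd j \<and> even q \<and>
     (\<exists>n. consecutive_numbering M q v n \<and> K = standard_odd q j v n)"

definition equiv_standard_even ::
    "'f flag_system \<Rightarrow> nat \<Rightarrow> nat \<Rightarrow> 'f set \<Rightarrow> 'f corner set \<Rightarrow> bool" where
  "equiv_standard_even M q j v K \<longleftrightarrow> j mod 4 = 2 \<and> 4 dvd q \<and>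
     (\<exists>n. consecutive_numbering M q v n \<and> K = standard_even q j v n)"

definition vertex_stabilizer :: "('f \<Rightarrow> 'f) set \<Rightarrow> 'f set \<Rightarrow> ('f \<Rightarrow> 'f) set" where
  "vertex_stabilizer G v = {g \<in> G. g ` v = v}"

definition labels :: "nat \<Rightarrow> int set" where
  "labels q = {0 ..< int q}"

text \<open>The permutations of the labels induced, via the numbering \<open>n\<close>, by a set \<open>H\<close> of
  symmetries fixing the vertex.\<close>

definition label_action :: "nat \<Rightarrow> (int \<Rightarrow> 'f set) \<Rightarrow> ('f \<Rightarrow> 'f) set \<Rightarrow> (int \<Rightarrow> int) set" where
  "label_action q n H =
     {\<sigma> \<in> Bij (labels q). \<exists>g \<in> H. \<forall>i \<in> labels q. g ` n i = n (\<sigma> i)}"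

definition mu :: "nat \<Rightarrow> int \<Rightarrow> int \<Rightarrow> int" where
  "mu q f = (\<lambda>i \<in> labels q. (f - i) mod int q)"

definition type_QD :: "'f flag_system \<Rightarrow> nat \<Rightarrow> ('f \<Rightarrow> 'f) set \<Rightarrow> 'f set \<Rightarrow> bool" where
  "type_QD M q G v \<longleftrightarrow> 4 dvd q \<and>
     (\<exists>n. consecutive_numbering M q v n \<and>
        label_action q n (vertex_stabilizer G v) =
          generate (BijGroup (labels q)) {mu q 1, mu q 5})"

end

theory Submission
  imports Defs
begin

text \<open>
  The flags at a vertex form a single cycle under \<open>adj1\<close> and \<open>adj2\<close>, so a symmetry fixing the
  vertex acts on the labels as a rotation \<open>i \<mapsto> i + a\<close> or a reflection \<open>i \<mapsto> f - i\<close>. Lift the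
  labels to \<open>\<int>\<close> and let \<open>S\<close> be the set of \<open>i\<close> such that \<open>L\<close> contains the corner \<open>c\<^sub>i\<close>; since
  \<open>L\<close> uses each dart once, \<open>\<int>\<close> is the disjoint union of \<open>S\<close> and \<open>S + j\<close>. The rotations form a
  subgroup \<open>d \<int>\<close>, and transitivity makes \<open>S\<close> a union of at most two of its cosets. Hence
  \<open>\<int> / d \<int>\<close> has two or four elements, so \<open>d\<close> is \<open>2\<close> or \<open>4\<close>. If \<open>S\<close> is a parity class, then
  \<open>j\<close> is odd. Otherwise \<open>d = 4\<close> and \<open>S\<close> consists of two adjacent classes modulo \<open>4\<close>, which
  forces \<open>j \<equiv> 2\<close> and a reflection swapping the two classes, hence type QD.
\<close>

section \<open>Orbits of a set of involutions\<close>

lemma orbit_under_refl: "x \<in> orbit_under R x"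
  by (simp add: orbit_under_def)

lemma orbit_under_step: "y \<in> orbit_under R x \<Longrightarrow> r \<in> R \<Longrightarrow> r y \<in> orbit_under R x"
  unfolding orbit_under_def by (auto intro: rtrancl_into_rtrancl)

lemma orbit_under_minimal:
  assumes "x \<in> X" and "\<And>r y. r \<in> R \<Longrightarrow> y \<in> X \<Longrightarrow> r y \<in> X"
  shows "orbit_under R x \<subseteq> X"
proof
  fix y assume "y \<in> orbit_under R x"
  then have "(x, y) \<in> {(a, r a) | a r. r \<in> R}\<^sup>*"
    by (simp add: orbit_under_def)
  then show "y \<in> X"
    by (induction rule: rtrancl_induct) (use assms in auto)
qed

text \<open>An involution undoes its own step, so reachability is symmetric. The generators are
  involutions only on \<open>A\<close>, hence the induction also carries membership in
  \<open>A\<close> along the path.\<close>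

lemma orbit_under_eq:
  assumes inv: "\<And>r y. r \<in> R \<Longrightarrow> y \<in> A \<Longrightarrow> r y \<in> A \<and> r (r y) = y"
    and x: "x \<in> A" and y: "y \<in> orbit_under R x"
  shows "orbit_under R y = orbit_under R x"
proof -
  have "(x, y) \<in> {(a, r a) | a r. r \<in> R}\<^sup>*"
    using y by (simp add: orbit_under_def)
  then have "y \<in> A \<and> orbit_under R y = orbit_under R x"
  proof (induction rule: rtrancl_induct)
    case base
    then show ?case using x by simp
  next
    case (step y z)
    then obtain r where r: "r \<in> R" "z = r y" by auto
    have yA: "y \<in> A" using step by simp
    have "orbit_under R z \<subseteq> orbit_under R y"
      using r by (intro orbit_under_minimal) (auto intro: orbit_under_step orbit_under_refl)
    moreover have "y \<in> orbit_under R z"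
      using inv[OF r(1) yA] r orbit_under_step[OF orbit_under_refl, of r R z] by simp
    then have "orbit_under R y \<subseteq> orbit_under R z"
      by (intro orbit_under_minimal) (auto intro: orbit_under_step)
    ultimately show ?case using step inv[OF r(1) yA] r by auto
  qed
  then show ?thesis by simp
qed

section \<open>Flags, edges and the rotation about a vertex\<close>

locale flag_map =
  fixes M :: "'f flag_system"
  assumes is_map: "is_map M"
begin

lemma adj_closed [simp]:
  "x \<in> flags M \<Longrightarrow> adj0 M x \<in> flags M"
  "x \<in> flags M \<Longrightarrow> adj1 M x \<in> flags M"
  "x \<in> flags M \<Longrightarrow> adj2 M x \<in> flags M"
  using is_map by (auto simp: is_map_def)

lemma adj_adj [simp]:
  "x \<in> flags M \<Longrightarrow> adj0 M (adj0 M x) = x"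
  "x \<in> flags M \<Longrightarrow> adj1 M (adj1 M x) = x"
  "x \<in> flags M \<Longrightarrow> adj2 M (adj2 M x) = x"
  using is_map by (auto simp: is_map_def)

lemma adj_neq:
  "x \<in> flags M \<Longrightarrow> adj1 M x \<noteq> x"
  "x \<in> flags M \<Longrightarrow> adj2 M x \<noteq> x"
  using is_map by (auto simp: is_map_def)

lemma adj_commute: "x \<in> flags M \<Longrightarrow> adj0 M (adj2 M x) = adj2 M (adj0 M x)"
  using is_map by (auto simp: is_map_def)

lemma no_loop: "x \<in> flags M \<Longrightarrow> vertex_of M (adj0 M x) \<noteq> vertex_of M x"
  using is_map by (auto simp: is_map_def)

lemma finite_flags: "finite (flags M)"
  using is_map by (auto simp: is_map_def)

lemma vertex_of_subset: "x \<in> flags M \<Longrightarrow> vertex_of M x \<subseteq> flags M"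
  unfolding vertex_of_def by (rule orbit_under_minimal) auto

lemma vertex_of_eq: "x \<in> flags M \<Longrightarrow> y \<in> vertex_of M x \<Longrightarrow> vertex_of M y = vertex_of M x"
  unfolding vertex_of_def by (rule orbit_under_eq[where A = "flags M"]) auto

lemma edge_of_eq: "x \<in> flags M \<Longrightarrow> y \<in> edge_of M x \<Longrightarrow> edge_of M y = edge_of M x"
  unfolding edge_of_def by (rule orbit_under_eq[where A = "flags M"]) auto

text \<open>The commuting involutions \<open>adj0 M\<close> and \<open>adj2 M\<close> admit only
  four reduced words, so the orbit closes after these.\<close>

lemma edge_of_explicit:
  assumes "x \<in> flags M"
  shows "edge_of M x = {x, adj0 M x, adj2 M x, adj0 M (adj2 M x)}"
proof
  show "edge_of M x \<subseteq> {x, adj0 M x, adj2 M x, adj0 M (adj2 M x)}"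
    unfolding edge_of_def
    by (rule orbit_under_minimal)
      (use assms adj_commute[of x] adj_commute[of "adj0 M x"] in \<open>auto simp: adj_commute\<close>)
  show "{x, adj0 M x, adj2 M x, adj0 M (adj2 M x)} \<subseteq> edge_of M x"
    unfolding edge_of_def by (auto intro: orbit_under_refl orbit_under_step)
qed

lemma edge_of_subset: "x \<in> flags M \<Longrightarrow> edge_of M x \<subseteq> flags M"
  by (simp add: edge_of_explicit)

lemma edge_of_adj2: "x \<in> flags M \<Longrightarrow> edge_of M (adj2 M x) = edge_of M x"
  by (rule edge_of_eq) (auto simp: edge_of_explicit)

text \<open>The two flags of the edge obtained through \<open>adj0 M\<close> lie at its other end,
  which is a different vertex because there are no loops.\<close>

lemma edge_of_same_vertex:
  assumes "x \<in> flags M" "y \<in> vertex_of M x" "edge_of M y = edge_of M x"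
  shows "y = x \<or> y = adj2 M x"
proof -
  have "y \<in> edge_of M y"
    by (simp add: edge_of_def orbit_under_refl)
  then have y: "y = x \<or> y = adj0 M x \<or> y = adj2 M x \<or> y = adj0 M (adj2 M x)"
    using assms edge_of_explicit by auto
  have "vertex_of M (adj2 M x) = vertex_of M x"
    using assms(1) by (intro vertex_of_eq) (auto simp: vertex_of_def intro: orbit_under_refl orbit_under_step)
  then show ?thesis
    using y no_loop[of x] no_loop[of "adj2 M x"] vertex_of_eq[OF assms(1,2)] assms(1) by auto
qed

text \<open>The step to the next edge at the vertex, in the direction used by
  \<open>consecutive_numbering\<close>.\<close>

definition rot :: "'f \<Rightarrow> 'f" where
  "rot y = adj2 M (adj1 M y)"

lemma rot_closed [simp]: "x \<in> flags M \<Longrightarrow> rot x \<in> flags M"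
  by (simp add: rot_def)

lemma rot_pow_closed [simp]: "x \<in> flags M \<Longrightarrow> (rot ^^ k) x \<in> flags M"
  by (induction k) auto

lemma rot_inj: "x \<in> flags M \<Longrightarrow> y \<in> flags M \<Longrightarrow> rot x = rot y \<Longrightarrow> x = y"
  unfolding rot_def by (metis adj_adj(2,3) adj_closed(2))

lemma rot_pow_inj:
  "x \<in> flags M \<Longrightarrow> y \<in> flags M \<Longrightarrow> (rot ^^ k) x = (rot ^^ k) y \<Longrightarrow> x = y"
proof (induction k)
  case (Suc k)
  then show ?case using rot_inj[of "(rot ^^ k) x" "(rot ^^ k) y"] by simp
qed simp

text \<open>The dihedral relation: \<open>adj2 M\<close> conjugates \<open>rot\<close> to its
  inverse. In this form only natural exponents occur.\<close>

lemma rot_pow_adj2: "x \<in> flags M \<Longrightarrow> (rot ^^ k) (adj2 M ((rot ^^ k) x)) = adj2 M x"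
proof (induction k)
  case (Suc k)
  have "(rot ^^ Suc k) (adj2 M ((rot ^^ Suc k) x)) = (rot ^^ k) (rot (adj2 M (rot ((rot ^^ k) x))))"
    by (simp add: funpow_swap1)
  also have "rot (adj2 M (rot ((rot ^^ k) x))) = adj2 M ((rot ^^ k) x)"
    using Suc.prems by (simp add: rot_def)
  finally show ?case using Suc by simp
qed simp

text \<open>A coincidence would be halved, along the cycle around the vertex, to a fixed point of
  \<open>adj2\<close> or of \<open>adj1\<close>.\<close>

lemma adj2_neq_rot_pow:
  assumes x: "x \<in> flags M"
  shows "adj2 M x \<noteq> (rot ^^ k) x"
proof
  assume eq: "adj2 M x = (rot ^^ k) x"
  define z where "z = (rot ^^ (k div 2)) x"
  have z: "z \<in> flags M" using x by (simp add: z_def)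
  have "(rot ^^ (k div 2)) (adj2 M z) = (rot ^^ k) x"
    using rot_pow_adj2[OF x] eq by (simp add: z_def)
  also have "k = k div 2 + (k mod 2 + k div 2)" by presburger
  then have "(rot ^^ k) x = (rot ^^ (k div 2)) ((rot ^^ (k mod 2)) z)"
    unfolding z_def by (metis funpow_add comp_apply)
  finally have "adj2 M z = (rot ^^ (k mod 2)) z"
    using rot_pow_inj z by (meson adj_closed(3) rot_pow_closed)
  moreover have "k mod 2 = 0 \<or> k mod 2 = 1" by presburger
  ultimately have "adj2 M z = z \<or> adj2 M z = adj2 M (adj1 M z)" by (auto simp: rot_def)
  then show False using adj_neq z by (metis adj_adj(3) adj_closed(2))
qed

text \<open>Finiteness forces a repetition among the powers, and injectivity of \<open>rot\<close>
  moves it back to \<open>x\<close>. The least positive period gives distinct flags along one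
  turn.\<close>

lemma rot_periodic:
  assumes x: "x \<in> flags M"
  obtains m where "m > 0" "(rot ^^ m) x = x" "inj_on (\<lambda>i. (rot ^^ i) x) {..<m}"
proof -
  have fin: "finite (range (\<lambda>i. (rot ^^ i) x))"
    using x by (auto intro!: finite_subset[OF _ finite_flags])
  have "\<not> inj (\<lambda>i. (rot ^^ i) x)"
    using fin finite_imageD by auto
  have cancel: "(rot ^^ (b - a)) x = x" if "a < b" "(rot ^^ a) x = (rot ^^ b) x" for a b
  proof -
    have "(rot ^^ a) ((rot ^^ (b - a)) x) = (rot ^^ a) x"
      using that by (metis comp_apply funpow_add le_add_diff_inverse less_imp_le)
    then show ?thesis using rot_pow_inj x by (meson rot_pow_closed)
  qed
  have "\<exists>m>0. (rot ^^ m) x = x"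
  proof -
    obtain a b where "a \<noteq> b" "(rot ^^ a) x = (rot ^^ b) x"
      using \<open>\<not> inj _\<close> by (auto simp: inj_def)
    then have "\<exists>a b. a < b \<and> (rot ^^ a) x = (rot ^^ b) x"
      by (metis linorder_less_linear)
    then show ?thesis using cancel zero_less_diff by blast
  qed
  define m where "m = (LEAST m. m > 0 \<and> (rot ^^ m) x = x)"
  have m: "m > 0 \<and> (rot ^^ m) x = x"
    unfolding m_def by (rule LeastI_ex) (use \<open>\<exists>m>0. _\<close> in blast)
  have least: "\<not> (k > 0 \<and> (rot ^^ k) x = x)" if "k < m" for k
    using that unfolding m_def by (rule not_less_Least)
  have "inj_on (\<lambda>i. (rot ^^ i) x) {..<m}"
  proof (rule linorder_inj_onI)
    fix a b assume "a < b" "a \<in> {..<m}" "b \<in> {..<m}"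
    then show "(rot ^^ a) x \<noteq> (rot ^^ b) x"
      using cancel[of a b] least[of "b - a"] by auto
  qed auto
  with m that show ?thesis by blast
qed

end

section \<open>Consecutive numberings and the cycle of flags at a vertex\<close>

definition numbering :: "'f flag_system \<Rightarrow> nat \<Rightarrow> 'f \<Rightarrow> int \<Rightarrow> 'f set" where
  "numbering M q x i = edge_of M (((adj2 M \<circ> adj1 M) ^^ nat (i mod int q)) x)"

lemma consecutive_numbering_iff:
  "consecutive_numbering M q v n \<longleftrightarrow> (\<exists>x\<in>v. n = numbering M q x)"
  unfolding consecutive_numbering_def numbering_def by (auto simp: fun_eq_iff)

locale flagged_vertex = flag_map M for M :: "'f flag_system" +
  fixes q :: nat and x :: 'f
  assumes valence: "has_valence M q" and x: "x \<in> flags M"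
begin

abbreviation v :: "'f set" where "v \<equiv> vertex_of M x"

lemma numbering_rot: "numbering M k y i = edge_of M ((rot ^^ nat (i mod int k)) y)"
proof -
  have "adj2 M \<circ> adj1 M = rot" by (simp add: fun_eq_iff rot_def)
  then show ?thesis by (simp add: numbering_def)
qed

lemma v_flags: "y \<in> v \<Longrightarrow> y \<in> flags M"
  using vertex_of_subset[OF x] by blast

lemma v_adj: "y \<in> v \<Longrightarrow> adj1 M y \<in> v" "y \<in> v \<Longrightarrow> adj2 M y \<in> v"
  unfolding vertex_of_def by (auto intro: orbit_under_step)

lemma v_vertex: "v \<in> vertices M"
  using x by (simp add: vertices_def)

lemma rot_pow_v: "(rot ^^ k) x \<in> v"
  by (induction k) (auto simp: v_adj rot_def, simp add: vertex_of_def orbit_under_refl)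

text \<open>One turn of \<open>rot\<close> passes each edge at the vertex once, and
  \<open>adj2 M\<close> adds the flags on the other sides. The length of the turn therefore counts
  the edges, which identifies it with the valence.\<close>

lemma rot_cycle:
  "q > 0" "(rot ^^ q) x = x"
  "v = (\<lambda>i. (rot ^^ i) x) ` {..<q} \<union> (\<lambda>i. adj2 M ((rot ^^ i) x)) ` {..<q}"
  "{e \<in> edges M. incident v e} = (\<lambda>i. edge_of M ((rot ^^ i) x)) ` {..<q}"
  "inj_on (\<lambda>i. edge_of M ((rot ^^ i) x)) {..<q}"
proof -
  obtain m where m: "m > 0" "(rot ^^ m) x = x" "inj_on (\<lambda>i. (rot ^^ i) x) {..<m}"
    using rot_periodic[OF x] by blast
  have mod: "(rot ^^ k) x \<in> (\<lambda>i. (rot ^^ i) x) ` {..<m}" for k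
    using funpow_mod_eq[OF m(2), of k] m(1) by (metis imageI lessThan_iff mod_less_divisor)
  have mod2: "adj2 M ((rot ^^ k) x) \<in> (\<lambda>i. adj2 M ((rot ^^ i) x)) ` {..<m}" for k
    using mod[of k] by auto
  have vm: "v = (\<lambda>i. (rot ^^ i) x) ` {..<m} \<union> (\<lambda>i. adj2 M ((rot ^^ i) x)) ` {..<m}"
    (is "v = ?W")
  proof
    show "v \<subseteq> ?W"
      unfolding vertex_of_def
    proof (rule orbit_under_minimal)
      show "x \<in> ?W" using mod[of 0] by simp
    next
      fix r y assume r: "r \<in> {adj1 M, adj2 M}" and "y \<in> ?W"
      then consider k where "y = (rot ^^ k) x" | k where "y = adj2 M ((rot ^^ k) x)" by auto
      then show "r y \<in> ?W"
      proof cases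
        case 1
        have "adj1 M y = adj2 M ((rot ^^ Suc k) x)"
          using 1 x by (simp add: rot_def)
        then show ?thesis using r 1 mod2[of "Suc k"] mod2[of k] by auto
      next
        case 2
        \<comment> \<open>This case steps backwards along the turn; the exponent
          \<open>k + (m - 1)\<close> stands for \<open>k - 1\<close> modulo the period and stays
          natural.\<close>
        have "(rot ^^ k) x = (rot ^^ Suc (k + (m - 1))) x"
          using m(1,2) funpow_mod_eq[OF m(2), of "k + m"] funpow_mod_eq[OF m(2), of k] by simp
        then have "adj1 M y = (rot ^^ (k + (m - 1))) x"
          using 2 x by (simp add: rot_def)
        then show ?thesis using r 2 mod[of "k + (m - 1)"] mod[of k] x by auto
      qed
    qed
    show "?W \<subseteq> v" using rot_pow_v v_adj by auto
  qed
  have em: "{e \<in> edges M. incident v e} = (\<lambda>i. edge_of M ((rot ^^ i) x)) ` {..<m}"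
  proof
    show "{e \<in> edges M. incident v e} \<subseteq> (\<lambda>i. edge_of M ((rot ^^ i) x)) ` {..<m}"
    proof
      fix e assume "e \<in> {e \<in> edges M. incident v e}"
      then obtain y z where yz: "y \<in> flags M" "e = edge_of M y" "z \<in> v" "z \<in> e"
        by (auto simp: edges_def incident_def)
      then have "e = edge_of M z" using edge_of_eq by blast
      then show "e \<in> (\<lambda>i. edge_of M ((rot ^^ i) x)) ` {..<m}"
        using yz(3) vm edge_of_adj2 x by (auto simp del: funpow.simps)
    qed
    have "(rot ^^ i) x \<in> edge_of M ((rot ^^ i) x)" for i
      by (simp add: edge_of_def orbit_under_refl)
    then show "(\<lambda>i. edge_of M ((rot ^^ i) x)) ` {..<m} \<subseteq> {e \<in> edges M. incident v e}"
      using rot_pow_v x by (auto simp: edges_def incident_def)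
  qed
  \<comment> \<open>Flags of the turn sharing an edge would be equal or related by
    \<open>adj2 M\<close>; the latter never happens between powers of \<open>rot\<close>.\<close>
  have injm: "inj_on (\<lambda>i. edge_of M ((rot ^^ i) x)) {..<m}"
  proof (rule linorder_inj_onI)
    fix a b assume ab: "a < b" "a \<in> {..<m}" "b \<in> {..<m}"
    show "edge_of M ((rot ^^ a) x) \<noteq> edge_of M ((rot ^^ b) x)"
    proof
      assume eq: "edge_of M ((rot ^^ a) x) = edge_of M ((rot ^^ b) x)"
      have "vertex_of M ((rot ^^ a) x) = v"
        using vertex_of_eq[OF x rot_pow_v] .
      then have "(rot ^^ b) x = (rot ^^ a) x \<or> (rot ^^ b) x = adj2 M ((rot ^^ a) x)"
        using edge_of_same_vertex[of "(rot ^^ a) x" "(rot ^^ b) x"] rot_pow_v x eq by auto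
      moreover have "(rot ^^ b) x = (rot ^^ (b - a)) ((rot ^^ a) x)"
        using ab by (metis comp_apply funpow_add le_add_diff_inverse2 less_imp_le)
      then have "(rot ^^ b) x \<noteq> adj2 M ((rot ^^ a) x)"
        using adj2_neq_rot_pow[of "(rot ^^ a) x" "b - a"] x by auto
      ultimately show False
        using inj_onD[OF m(3), of b a] ab by simp
    qed
  qed auto
  have "card {e \<in> edges M. incident v e} = m"
    unfolding em using card_image[OF injm] by simp
  then have "m = q"
    using valence v_vertex unfolding has_valence_def by metis
  then show "q > 0" "(rot ^^ q) x = x"
    "v = (\<lambda>i. (rot ^^ i) x) ` {..<q} \<union> (\<lambda>i. adj2 M ((rot ^^ i) x)) ` {..<q}"
    "{e \<in> edges M. incident v e} = (\<lambda>i. edge_of M ((rot ^^ i) x)) ` {..<q}"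
    "inj_on (\<lambda>i. edge_of M ((rot ^^ i) x)) {..<q}"
    using m(1,2) vm em injm by simp_all
qed

text \<open>Indexing the turn by integers modulo \<open>q\<close> makes backward rotation available,
  so numberings can be shifted and reflected by integer arithmetic.\<close>

definition fl :: "int \<Rightarrow> 'f" where
  "fl i = (rot ^^ nat (i mod int q)) x"

abbreviation n :: "int \<Rightarrow> 'f set" where "n \<equiv> numbering M q x"

lemma fl_flags [simp]: "fl i \<in> flags M"
  by (simp add: fl_def x)

lemma n_fl: "n i = edge_of M (fl i)"
  by (simp add: numbering_rot fl_def)

lemma fl_add: "(rot ^^ k) (fl i) = fl (i + int k)"
proof -
  have q: "int q > 0" using rot_cycle(1) by simp
  have "(rot ^^ k) (fl i) = (rot ^^ (k + nat (i mod int q))) x"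
    by (simp add: fl_def funpow_add)
  also have "\<dots> = (rot ^^ ((k + nat (i mod int q)) mod q)) x"
    using funpow_mod_eq[OF rot_cycle(2)] by metis
  also have "(k + nat (i mod int q)) mod q = nat ((i + int k) mod int q)"
  proof -
    have "int ((k + nat (i mod int q)) mod q) = (i + int k) mod int q"
      using q by (simp add: zmod_int mod_simps add.commute)
    then show ?thesis by (metis nat_int)
  qed
  finally show ?thesis by (simp add: fl_def)
qed

lemma fl_adj2: "(rot ^^ k) (adj2 M (fl i)) = adj2 M (fl (i - int k))"
  using rot_pow_adj2[of "fl (i - int k)" k] fl_add[of k "i - int k"] by simp

lemma fl_cong: "[i = k] (mod int q) \<Longrightarrow> fl i = fl k"
  by (simp add: fl_def cong_def)

lemma n_cong: "[i = k] (mod int q) \<Longrightarrow> n i = n k"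
  by (simp add: n_fl fl_cong)

lemma n_eq_iff: "n i = n k \<longleftrightarrow> [i = k] (mod int q)"
proof
  assume "n i = n k"
  then have "edge_of M ((rot ^^ nat (i mod int q)) x) = edge_of M ((rot ^^ nat (k mod int q)) x)"
    by (simp add: n_fl fl_def)
  moreover have "nat (i mod int q) \<in> {..<q}" "nat (k mod int q) \<in> {..<q}"
    using rot_cycle(1) by (simp_all add: nat_less_iff)
  ultimately have "nat (i mod int q) = nat (k mod int q)"
    by (rule inj_onD[OF rot_cycle(5)])
  then show "[i = k] (mod int q)"
    using rot_cycle(1) by (simp add: cong_def eq_nat_nat_iff)
qed (rule n_cong)

lemma rot_pow_fl: "i < q \<Longrightarrow> (rot ^^ i) x = fl (int i)"
  by (simp add: fl_def zmod_int[symmetric])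

lemma v_fl:
  assumes "y \<in> v"
  obtains a where "y = fl a" | f where "y = adj2 M (fl f)"
  using assms rot_cycle(3) rot_pow_fl that by auto

lemma fl_v: "fl i \<in> v"
  by (simp add: fl_def rot_pow_v)

lemma incident_n: "{e \<in> edges M. incident v e} = range n"
proof
  show "{e \<in> edges M. incident v e} \<subseteq> range n"
    using rot_cycle(4) rot_pow_fl n_fl by auto
  show "range n \<subseteq> {e \<in> edges M. incident v e}"
    unfolding rot_cycle(4) numbering_rot
    using rot_cycle(1) by (auto simp: nat_less_iff intro!: imageI)
qed

lemma numbering_fl: "numbering M q (fl a) = (\<lambda>i. n (i + a))"
proof
  fix i
  have "numbering M q (fl a) i = n (a + i mod int q)"
    using rot_cycle(1) by (simp add: numbering_rot[of q "fl a"] fl_add n_fl)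
  also have "\<dots> = n (i + a)"
    by (rule n_cong) (simp add: cong_def mod_simps add.commute)
  finally show "numbering M q (fl a) i = n (i + a)" .
qed

lemma numbering_adj2_fl: "numbering M q (adj2 M (fl f)) = (\<lambda>i. n (f - i))"
proof
  fix i
  have "numbering M q (adj2 M (fl f)) i = n (f - i mod int q)"
    using rot_cycle(1) by (simp add: numbering_rot[of q "adj2 M (fl f)"] fl_adj2 edge_of_adj2 n_fl)
  also have "\<dots> = n (f - i)"
    by (rule n_cong) (simp add: cong_def mod_simps)
  finally show "numbering M q (adj2 M (fl f)) i = n (f - i)" .
qed

text \<open>These are the \<open>2 q\<close> equivalent numberings: a base flag on the turn
  translates the labels, one on the other side of its edge reverses the direction.\<close>

lemma numbering_at:
  assumes "y \<in> v"
  obtains a where "numbering M q y = (\<lambda>i. n (i + a))" | f where "numbering M q y = (\<lambda>i. n (f - i))"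
  using assms by (cases rule: v_fl) (use numbering_fl numbering_adj2_fl that in auto)

lemma numbering_shift: "consecutive_numbering M q v (\<lambda>i. n (i + s))"
  using fl_v numbering_fl consecutive_numbering_iff by metis

text \<open>Symmetries commute with all adjacencies, hence with \<open>rot\<close>, and so carry the
  turn starting at \<open>x\<close> to the one starting at \<open>g x\<close>.\<close>

lemma Aut_numbering:
  assumes g: "g \<in> Aut_map M"
  shows "g ` n i = numbering M q (g x) i"
proof -
  have com: "g (adj0 M y) = adj0 M (g y) \<and> g (adj1 M y) = adj1 M (g y) \<and> g (adj2 M y) = adj2 M (g y)"
    if "y \<in> flags M" for y using g that by (simp add: Aut_map_def)
  have fg: "g y \<in> flags M" if "y \<in> flags M" for y
    using g that by (auto simp: Aut_map_def Bij_def bij_betw_def)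
  have "g (rot y) = rot (g y)" if "y \<in> flags M" for y
    using com that by (simp add: rot_def)
  then have "g ((rot ^^ k) x) = (rot ^^ k) (g x)" for k
    by (induction k) (simp_all add: x)
  then have "g (fl i) = (rot ^^ nat (i mod int q)) (g x)"
    by (simp add: fl_def)
  moreover have "g ` edge_of M (fl i) = edge_of M (g (fl i))"
    by (simp add: edge_of_explicit com fg)
  ultimately show ?thesis by (simp add: n_fl numbering_rot[of q "g x"])
qed

lemma stabilizer_action:
  assumes "g \<in> Aut_map M" "g ` v = v"
  obtains a where "\<And>i. g ` n i = n (i + a)" | f where "\<And>i. g ` n i = n (f - i)"
proof -
  have "g x \<in> v" using assms(2) rot_pow_v[of 0] by auto
  then show ?thesis
    by (cases rule: numbering_at) (use Aut_numbering[OF assms(1)] that in auto)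
qed

end

section \<open>Subgroups of the integers and arithmetic of their cosets\<close>

lemma int_subgroup_multiples:
  fixes A :: "int set"
  assumes add: "\<And>a b. a \<in> A \<Longrightarrow> b \<in> A \<Longrightarrow> a + b \<in> A"
    and uminus: "\<And>a. a \<in> A \<Longrightarrow> - a \<in> A"
    and pos: "p \<in> A" "p > 0"
  obtains d where "d > 0" "A = {a. d dvd a}"
proof -
  define k where "k = (LEAST k. k > 0 \<and> int k \<in> A)"
  have k: "k > 0 \<and> int k \<in> A"
    unfolding k_def by (rule LeastI[of _ "nat p"]) (use pos in auto)
  have mult: "a * int m \<in> A" if "a \<in> A" for a m
  proof (induction m)
    case 0
    show ?case using add[OF that uminus[OF that]] by simp
  next
    case (Suc m)
    then show ?case using add[OF that Suc] by (simp add: algebra_simps)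
  qed
  \<comment> \<open>The remainder on division by \<open>int k\<close> lies in \<open>A\<close> and
    is smaller than the least positive member, hence zero.\<close>
  have dvd: "int k dvd a" if "a \<in> A" for a
  proof -
    have *: "int k * (a div int k) \<in> A"
      using mult[of "int k" "nat (a div int k)"] mult[of "- int k" "nat (- (a div int k))"]
        uminus k by (cases "a div int k \<ge> 0") auto
    have "a mod int k \<in> A"
      using add[OF that uminus[OF *]] by (simp add: minus_mult_div_eq_mod)
    moreover have "a mod int k \<ge> 0" "a mod int k < int k" using k by simp_all
    ultimately have "\<not> 0 < nat (a mod int k)"
      using not_less_Least[of "nat (a mod int k)" "\<lambda>k. k > 0 \<and> int k \<in> A"]
      unfolding k_def[symmetric] by (simp add: nat_less_iff)
    then show ?thesis using \<open>a mod int k \<ge> 0\<close> by auto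
  qed
  have "a \<in> A" if a: "int k dvd a" for a
  proof -
    obtain c where c: "a = int k * c" using a by (auto simp: dvd_def)
    show ?thesis
      using c mult[of "int k" "nat c"] mult[of "- int k" "nat (- c)"] uminus k
      by (cases "c \<ge> 0") auto
  qed
  with dvd k show ?thesis by (intro that[of "int k"]) auto
qed

text \<open>\<open>A\<close> and \<open>B\<close> are the shifts \<open>a\<close> of the rotations \<open>i \<mapsto> i + a\<close> and the values \<open>f\<close> of the
  reflections \<open>i \<mapsto> f - i\<close> in the local action; the reflection \<open>f\<close> maps the corner
  \<open>{i, i + j}\<close> to \<open>{f - j - i, f - i}\<close>.\<close>

lemma local_corneration_cases:
  fixes A B S :: "int set" and j q :: int
  assumes add: "\<And>a b. a \<in> A \<Longrightarrow> b \<in> A \<Longrightarrow> a + b \<in> A"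
    and uminus: "\<And>a. a \<in> A \<Longrightarrow> - a \<in> A"
    and q: "q \<in> A" "q > 0"
    and BB: "\<And>f f'. f \<in> B \<Longrightarrow> f' \<in> B \<Longrightarrow> f - f' \<in> A"
    and AB: "\<And>a f. a \<in> A \<Longrightarrow> f \<in> B \<Longrightarrow> a + f \<in> B"
    and SA: "\<And>i a. i \<in> S \<Longrightarrow> a \<in> A \<Longrightarrow> i + a \<in> S"
    and SB: "\<And>i f. i \<in> S \<Longrightarrow> f \<in> B \<Longrightarrow> f - j - i \<in> S"
    and S: "\<And>i. i \<in> S \<longleftrightarrow> i + j \<notin> S"
    and trans: "\<And>i k. i \<in> S \<Longrightarrow> k \<in> S \<Longrightarrow> k - i \<in> A \<or> i + k + j \<in> B"
  shows "(odd j \<and> even q \<and> (\<exists>s. S = {i. even (i - s)})) \<or>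
    (j mod 4 = 2 \<and> 4 dvd q \<and>
      (\<exists>s. S = {i. (i - s) mod 4 \<in> {0, 3}} \<and> A = {a. 4 dvd a} \<and> B = {f. (f - 2 * s) mod 4 = 1}))"
proof -
  obtain d where d: "d > 0" "A = {a. d dvd a}"
    using int_subgroup_multiples[OF add uminus q] by blast
  have dq: "d dvd q" using q d by simp
  obtain s where s: "s \<in> S" using S by blast
  \<comment> \<open>The split is whether \<open>S\<close> is a single coset of \<open>A\<close> or
    not.\<close>
  show ?thesis
  proof (cases "\<exists>t. t \<in> S \<and> \<not> d dvd (t - s)")
    case False
    have S_eq: "S = {i. d dvd (i - s)}"
      using False SA[OF s] d by (auto, metis add_diff_cancel_left' diff_add_cancel add.commute mem_Collect_eq)
    \<comment> \<open>\<open>S\<close> and its translate by \<open>j\<close> cover the integers, so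
      only two residues modulo \<open>d\<close> can occur.\<close>
    have "{0..<d} \<subseteq> {s mod d, (s + j) mod d}"
    proof
      fix i assume i: "i \<in> {0..<d}"
      have "i \<in> S \<or> i - j \<in> S" using S[of "i - j"] by auto
      then have "d dvd (i - s) \<or> d dvd (i - (s + j))" using S_eq by (auto simp: algebra_simps)
      then show "i \<in> {s mod d, (s + j) mod d}"
        using i by (auto simp: mod_eq_dvd_iff[symmetric])
    qed
    then have "card {0..<d} \<le> card {s mod d, (s + j) mod d}" by (rule card_mono[rotated]) simp
    also have "\<dots> \<le> 2" by (simp add: card_insert_if)
    finally have "d \<le> 2" by simp
    moreover have "\<not> d dvd j" using S[of s] s S_eq by auto
    then have "d \<noteq> 1" by auto
    ultimately have "d = 2" using d by simp
    then show ?thesis using S_eq \<open>\<not> d dvd j\<close> dq by auto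
  next
    case True
    then obtain t0 where t0: "t0 \<in> S" "\<not> d dvd (t0 - s)" by blast
    \<comment> \<open>No rotation takes \<open>s\<close> to \<open>t0\<close>, so transitivity must
      supply a reflection.\<close>
    have B0: "s + t0 + j \<in> B" using trans[OF s t0(1)] t0(2) d by auto
    have S_sub: "d dvd (i - s) \<or> d dvd (i - t0)" if "i \<in> S" for i
    proof (rule disjCI)
      assume "\<not> d dvd (i - t0)"
      show "d dvd (i - s)"
      proof (rule ccontr)
        assume "\<not> d dvd (i - s)"
        then have "s + i + j \<in> B" using trans[OF s that] d by auto
        \<comment> \<open>The reflections taking \<open>s\<close> to \<open>i\<close> and to
          \<open>t0\<close> differ by the rotation \<open>i - t0\<close>, which puts
          \<open>i\<close> in the coset of \<open>t0\<close>.\<close>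
        then have "(s + i + j) - (s + t0 + j) \<in> A" using BB B0 by blast
        then show False using \<open>\<not> d dvd (i - t0)\<close> d by auto
      qed
    qed
    have S_eq: "i \<in> S \<longleftrightarrow> d dvd (i - s) \<or> d dvd (i - t0)" for i
      using S_sub[of i] SA[OF s, of "i - s"] SA[OF t0(1), of "i - t0"] d by auto
    \<comment> \<open>The cosets of \<open>s\<close> and \<open>t0\<close> and their translates by
      \<open>j\<close> fill all residues. They are distinct because \<open>S\<close> and its
      translate are disjoint, so \<open>d\<close> is 4.\<close>
    let ?R = "{s mod d, t0 mod d, (s + j) mod d, (t0 + j) mod d}"
    have "{0..<d} = ?R"
    proof
      show "{0..<d} \<subseteq> ?R"
      proof
        fix i assume i: "i \<in> {0..<d}"
        have "i \<in> S \<or> i - j \<in> S" using S[of "i - j"] by auto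
        then have "d dvd (i - s) \<or> d dvd (i - t0) \<or> d dvd (i - (s + j)) \<or> d dvd (i - (t0 + j))"
          using S_eq by (auto simp: algebra_simps)
        then show "i \<in> ?R"
          using i by (auto simp: mod_eq_dvd_iff[symmetric])
      qed
      show "?R \<subseteq> {0..<d}" using d by auto
    qed
    moreover have "s mod d \<noteq> t0 mod d" "(s + j) mod d \<noteq> (t0 + j) mod d"
      using t0(2) by (auto simp: mod_eq_dvd_iff dvd_diff_commute)
    moreover have "\<not> d dvd (s + j - s)" "\<not> d dvd (s + j - t0)" "\<not> d dvd (t0 + j - s)" "\<not> d dvd (t0 + j - t0)"
      using S[of s] S[of t0] s t0(1) S_eq by blast+
    then have ne: "s mod d \<noteq> (s + j) mod d" "t0 mod d \<noteq> (s + j) mod d"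
        "s mod d \<noteq> (t0 + j) mod d" "t0 mod d \<noteq> (t0 + j) mod d"
      by (metis mod_eq_dvd_iff)+
    ultimately have "card {0..<d} = 4" by simp
    then have d4: "d = 4" by simp
    have S4: "i \<in> S \<longleftrightarrow> 4 dvd (i - s) \<or> 4 dvd ((i - s) - (t0 - s))" for i
      using S_eq[of i] d4 by simp
    have w: "\<not> 4 dvd (t0 - s)"
      using t0(2) d4 by simp
    have j: "\<not> 4 dvd j" "\<not> 4 dvd (j - (t0 - s))" "\<not> 4 dvd ((t0 - s) + j)"
      using S[of s] S[of t0] s t0(1) S4[of "s + j"] S4[of "t0 + j"] by (auto simp: algebra_simps)
    show ?thesis
    \<comment> \<open>An even difference is 2 modulo 4, and the two classes merge into a parity
      class although the rotations are only the multiples of 4. An odd difference makes the classes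
      adjacent.\<close>
    proof (cases "even (t0 - s)")
      case True
      have "4 dvd e \<or> 4 dvd (e - (t0 - s)) \<longleftrightarrow> even e" for e
        using w True by presburger
      then have "S = {i. even (i - s)}" using S4 by blast
      moreover have "odd j" using w True j by presburger
      ultimately show ?thesis using dq d4 by auto
    next
      case False
      \<comment> \<open>Here \<open>j\<close> avoids 0 and both odd residues, namely
        \<open>t0 - s\<close> and its negative.\<close>
      have j2: "j mod 4 = 2" using False j by presburger
      \<comment> \<open>The two adjacent classes are named so that \<open>t\<close> is congruent to
        \<open>u - 1\<close>; relative to \<open>u\<close> they become 0 and 3.\<close>
      obtain u t where ut: "(t - u) mod 4 = 3" "u = s \<and> t = t0 \<or> u = t0 \<and> t = s"
      proof -
        have "(t0 - s) mod 4 = 3 \<or> (s - t0) mod 4 = 3" using False by presburger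
        then show ?thesis using that by blast
      qed
      have B_ut: "u + t + j \<in> B" using B0 ut(2) by (auto simp: add.commute)
      have "4 dvd e \<or> 4 dvd (e - (t - u)) \<longleftrightarrow> e mod 4 = 0 \<or> e mod 4 = 3" for e
        using ut(1) by presburger
      then have "4 dvd (i - u) \<or> 4 dvd (i - t) \<longleftrightarrow> (i - u) mod 4 = 0 \<or> (i - u) mod 4 = 3" for i
        by (metis diff_diff_eq2 diff_add_cancel)
      moreover have "i \<in> S \<longleftrightarrow> 4 dvd (i - u) \<or> 4 dvd (i - t)" for i
        using S_eq[of i] ut(2) d4 by auto
      ultimately have S_u: "S = {i. (i - u) mod 4 \<in> {0, 3}}"
        by auto
      have "4 dvd (e - (w + j)) \<longleftrightarrow> e mod 4 = 1" if "w mod 4 = 3" for e w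
        using that j2 by presburger
      note e = this[OF ut(1)]
      have "f \<in> B \<longleftrightarrow> 4 dvd (f - (u + t + j))" for f
        using BB[OF _ B_ut, of f] AB[OF _ B_ut, of "f - (u + t + j)"] d d4 by auto
      \<comment> \<open>Relative to \<open>2 * u\<close>, the reflection value
        \<open>u + t + j\<close> is congruent to \<open>3 + 2\<close>, that is to 1 modulo
        4.\<close>
      moreover have "f - (u + t + j) = (f - 2 * u) - ((t - u) + j)" for f
        by simp
      ultimately have "f \<in> B \<longleftrightarrow> (f - 2 * u) mod 4 = 1" for f
        by (metis e)
      then have "B = {f. (f - 2 * u) mod 4 = 1}" by blast
      then show ?thesis using S_u j2 d d4 dq by blast
    qed
  qed
qed

section \<open>Rotations and reflections of the labels\<close>

lemma mu_Bij: "mu q f \<in> Bij (labels q)"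
proof -
  have inv: "(f - (f - i) mod int q) mod int q = i" if "i \<in> labels q" for i
    using that by (simp add: labels_def mod_simps)
  have "bij_betw (mu q f) (labels q) (labels q)"
    by (rule bij_betw_byWitness[where f' = "mu q f"]) (use inv in \<open>auto simp: mu_def labels_def\<close>)
  then show ?thesis by (simp add: Bij_def mu_def)
qed

lemma mu_cong: "[f = f'] (mod int q) \<Longrightarrow> mu q f = mu q f'"
  unfolding mu_def by (intro restrict_ext) (metis cong_def cong_diff cong_refl)

text \<open>The rotations that complete the reflections \<open>mu\<close> to the dihedral group,
  restricted to \<open>labels q\<close> so that they are elements of
  \<open>BijGroup\<close>.\<close>

definition rho :: "nat \<Rightarrow> int \<Rightarrow> int \<Rightarrow> int" where
  "rho q a = (\<lambda>i \<in> labels q. (i + a) mod int q)"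

lemma mod_labels: "i \<in> labels q \<Longrightarrow> k mod int q \<in> labels q"
  by (auto simp: labels_def)

lemma compose_mu_rho:
  "compose (labels q) (mu q f) (mu q f') = rho q (f - f')"
  "compose (labels q) (rho q a) (mu q f) = mu q (a + f)"
  "compose (labels q) (mu q f) (rho q a) = mu q (f - a)"
  "compose (labels q) (rho q a) (rho q b) = rho q (a + b)"
proof -
  have "(f - (f' - i) mod int q) mod int q = (i + (f - f')) mod int q"
    "((f - i) mod int q + a) mod int q = (a + f - i) mod int q"
    "(f - (i + a) mod int q) mod int q = (f - a - i) mod int q"
    "((i + b) mod int q + a) mod int q = (i + (a + b)) mod int q" for i
    by (simp_all only: mod_simps) (simp_all only: algebra_simps)
  then show "compose (labels q) (mu q f) (mu q f') = rho q (f - f')"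
    "compose (labels q) (rho q a) (mu q f) = mu q (a + f)"
    "compose (labels q) (mu q f) (rho q a) = mu q (f - a)"
    "compose (labels q) (rho q a) (rho q b) = rho q (a + b)"
    by (simp_all add: compose_def mu_def rho_def mod_labels cong: restrict_cong)
qed

lemma rho_zero: "rho q 0 = (\<lambda>i \<in> labels q. i)"
  by (auto simp: fun_eq_iff rho_def labels_def)

lemma rho_Bij: "rho q a \<in> Bij (labels q)"
  using compose_Bij[OF mu_Bij mu_Bij, of q a 0] by (simp add: compose_mu_rho)

text \<open>Two reflections compose to a rotation by the difference of their values, here
  \<open>5 - 1 = 4\<close>. All values stay in their class modulo 4, and \<open>4 dvd q\<close>
  makes that class well defined on labels.\<close>

lemma generate_mu:
  assumes "4 dvd q" "q > 0"
  shows "generate (BijGroup (labels q)) {mu q 1, mu q 5} =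
    rho q ` {a. 4 dvd a} \<union> mu q ` {f. f mod 4 = 1}" (is "?G = ?T")
proof
  interpret group "BijGroup (labels q)" by (rule group_BijGroup)
  have mult: "x \<otimes>\<^bsub>BijGroup (labels q)\<^esub> y = compose (labels q) x y"
    if "x \<in> Bij (labels q)" "y \<in> Bij (labels q)" for x y
    using that by (simp add: BijGroup_def)
  have one: "\<one>\<^bsub>BijGroup (labels q)\<^esub> = rho q 0"
    by (simp add: BijGroup_def rho_zero)
  have carrier: "carrier (BijGroup (labels q)) = Bij (labels q)"
    by (simp add: BijGroup_def)
  have inv_mu: "inv\<^bsub>BijGroup (labels q)\<^esub> (mu q f) = mu q f" for f
    by (rule inv_equality) (simp_all add: mult mu_Bij compose_mu_rho one carrier)
  show "?G \<subseteq> ?T"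
  proof
    fix g assume "g \<in> ?G"
    then show "g \<in> ?T"
    proof (induction rule: generate.induct)
      case one
      then show ?case using \<open>\<one>\<^bsub>BijGroup (labels q)\<^esub> = rho q 0\<close> by auto
    next
      case (incl h)
      then show ?case by auto
    next
      case (inv h)
      then show ?case using inv_mu by auto
    next
      case (eng h1 h2)
      have h: "h1 \<otimes>\<^bsub>BijGroup (labels q)\<^esub> h2 = compose (labels q) h1 h2"
        using eng(3,4) by (intro mult) (auto simp: mu_Bij rho_Bij)
      show ?case
        unfolding h using eng(3,4)
        by (elim UnE imageE; simp add: compose_mu_rho; intro disjI1 disjI2 imageI; simp; presburger)
    qed
  qed
  have mu1: "mu q 1 \<in> ?G" and mu5: "mu q 5 \<in> ?G"
    by (auto intro: generate.incl)
  have "rho q 4 \<in> ?G"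
    using generate.eng[OF mu5 mu1] by (simp add: mult mu_Bij compose_mu_rho)
  \<comment> \<open>Repeated products with \<open>rho q 4\<close> reach nonnegative multiples of 4;
    an arbitrary value is afterwards reduced modulo \<open>q\<close>, which keeps its residue modulo
    4.\<close>
  have mu_nat: "mu q (1 + 4 * int k) \<in> ?G" for k
  proof (induction k)
    case (Suc k)
    show ?case
      using generate.eng[OF \<open>rho q 4 \<in> ?G\<close> Suc]
      by (simp add: mult mu_Bij rho_Bij compose_mu_rho algebra_simps)
  qed (simp add: mu1)
  have mu_G: "mu q f \<in> ?G" if "f mod 4 = 1" for f
  proof -
    have "(f mod int q) mod 4 = 1"
      using that assms(1) by (metis int_dvd_int_iff mod_mod_cancel of_nat_numeral)
    then have "f mod int q = 1 + 4 * (f mod int q div 4)"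
      by (metis add.commute mult.commute div_mult_mod_eq)
    moreover have "f mod int q div 4 \<ge> 0" using assms by (simp add: pos_imp_zdiv_nonneg_iff)
    ultimately have "f mod int q = 1 + 4 * int (nat (f mod int q div 4))" by simp
    moreover have "mu q f = mu q (f mod int q)"
      by (rule mu_cong) (simp add: cong_def)
    ultimately show ?thesis using mu_nat by metis
  qed
  have "rho q a \<in> ?G" if "4 dvd a" for a
  proof -
    \<comment> \<open>The rotation by \<open>a\<close> is the product of the reflections with values
      \<open>a + 1\<close> and 1.\<close>
    have "(a + 1) mod 4 = 1" using that by presburger
    from generate.eng[OF mu_G[OF this] mu1] show ?thesis
      by (simp add: mult mu_Bij compose_mu_rho)
  qed
  then show "?T \<subseteq> ?G" using mu_G by auto
qed

section \<open>Composition of symmetries\<close>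

lemma (in flag_map) Aut_map_compose:
  assumes "g \<in> Aut_map M" "h \<in> Aut_map M"
  shows "compose (flags M) g h \<in> Aut_map M"
proof -
  have "h x \<in> flags M" if "x \<in> flags M" for x
    using assms(2) that by (auto simp: Aut_map_def Bij_def bij_betw_def)
  moreover have "compose (flags M) g h \<in> Bij (flags M)"
    using assms by (simp add: Aut_map_def compose_Bij)
  ultimately show ?thesis
    using assms by (simp add: Aut_map_def compose_def)
qed

text \<open>\<open>compose (flags M) g h\<close> agrees with the composition only on flags;
  \<open>L \<subseteq> corners M\<close> ensures that the corners are built from sets of
  flags.\<close>

lemma (in flag_map) Aut_corneration_compose:
  assumes "g \<in> Aut_corneration M L" "h \<in> Aut_corneration M L" "L \<subseteq> corners M"
  shows "compose (flags M) g h \<in> Aut_corneration M L"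
proof -
  have im: "compose (flags M) g h ` Y = g ` h ` Y" if "Y \<subseteq> flags M" for Y
    using that by (force simp: compose_def image_iff)
  have "move_corner (compose (flags M) g h) c = move_corner g (move_corner h c)" if cL: "c \<in> L" for c
  proof -
    have "c \<in> corners M" using assms(3) cL by blast
    then obtain w e1 e2 where c: "c = (w, {e1, e2})" "w \<in> vertices M" "e1 \<in> edges M" "e2 \<in> edges M"
      by (auto simp: corners_def darts_def)
    then have "w \<subseteq> flags M" "e1 \<subseteq> flags M" "e2 \<subseteq> flags M"
      using vertex_of_subset edge_of_subset by (auto simp: vertices_def edges_def)
    then show ?thesis by (simp add: c(1) move_corner_def im)
  qed
  then have "move_corner (compose (flags M) g h) ` L = move_corner g ` move_corner h ` L"
    by (simp add: image_image)
  then show ?thesis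
    using assms Aut_map_compose by (simp add: Aut_corneration_def)
qed

section \<open>The local action in terms of integers\<close>

locale vertex_corneration = flagged_vertex M q x for M :: "'f flag_system" and q x +
  fixes j :: nat and L :: "'f corner set"
  assumes j: "1 \<le> j" "2 * j < q"
    and L: "j_corneration M q j L" and L_transitive: "transitive_corneration M L"
begin

abbreviation c :: "int \<Rightarrow> 'f corner" where "c \<equiv> numbered_corner v n j"

definition S :: "int set" where "S = {i. c i \<in> L}"

definition H :: "('f \<Rightarrow> 'f) set" where "H = vertex_stabilizer (Aut_corneration M L) v"

text \<open>Shifts are collected as integers instead of residues, so that \<open>A\<close> becomes a
  subgroup of \<int> containing \<open>q\<close>.\<close>

definition A :: "int set" where "A = {a. \<exists>g\<in>H. \<forall>i. g ` n i = n (i + a)}"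

definition B :: "int set" where "B = {f. \<exists>g\<in>H. \<forall>i. g ` n i = n (f - i)}"

lemma L_corners: "L \<subseteq> corners M"
  using L by (simp add: j_corneration_def corneration_def)

lemma not_cong: "\<not> [i = i + int j] (mod int q)" "\<not> [i = i + 2 * int j] (mod int q)"
proof -
  have "\<not> int q dvd int j" "\<not> int q dvd 2 * int j"
    using j by (auto dest!: zdvd_imp_le)
  then show "\<not> [i = i + int j] (mod int q)" "\<not> [i = i + 2 * int j] (mod int q)"
    by (simp_all add: cong_iff_dvd_diff)
qed

text \<open>Two corners could also agree with their edges interchanged; this would make
  \<open>2 * j\<close> vanish modulo \<open>q\<close>, which \<open>1 \<le> j\<close> and
  \<open>2 * j < q\<close> exclude.\<close>

lemma c_eq_iff: "c i = c k \<longleftrightarrow> [i = k] (mod int q)"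
proof
  assume "[i = k] (mod int q)"
  moreover from this have "[i + int j = k + int j] (mod int q)" by (simp add: cong_add)
  ultimately show "c i = c k" using n_cong by (simp add: numbered_corner_def)
next
  assume "c i = c k"
  then have "n i = n k \<or> n i = n (k + int j) \<and> n (i + int j) = n k"
    by (auto simp: numbered_corner_def doubleton_eq_iff)
  moreover have "\<not> (n i = n (k + int j) \<and> n (i + int j) = n k)"
  proof
    assume "n i = n (k + int j) \<and> n (i + int j) = n k"
    then have *: "[i = k + int j] (mod int q)" "[i + int j = k] (mod int q)"
      unfolding n_eq_iff by simp_all
    have "[i + int j = k + int j + int j] (mod int q)"
      by (rule cong_add[OF *(1) cong_refl])
    then have "[k = k + 2 * int j] (mod int q)"
      using *(2) by (simp add: cong_def algebra_simps)
    then show False using not_cong by simp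
  qed
  ultimately show "[i = k] (mod int q)" using n_eq_iff by blast
qed

lemma S_cong: "[i = k] (mod int q) \<Longrightarrow> i \<in> S \<longleftrightarrow> k \<in> S"
  by (simp add: S_def flip: c_eq_iff)

text \<open>A \<open>j\<close>-corner may be witnessed in any numbering and with either sign of the
  difference. Passing to \<open>n\<close> keeps the difference up to sign, and the choice of the
  first edge fixes the sign.\<close>

lemma local_corner:
  assumes d: "d \<in> L" "fst d = v"
  obtains i where "i \<in> S" "d = c i"
proof -
  have "j_corner M q j d" using L d by (simp add: j_corneration_def)
  then obtain y a b where y: "y \<in> v" "snd d = {numbering M q y a, numbering M q y b}"
      and ab: "[b - a = int j] (mod int q) \<or> [b - a = - int j] (mod int q)"
    using d(2) by (auto simp: j_corner_def consecutive_numbering_iff)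
  have "\<exists>a b. snd d = {n a, n b} \<and> ([b - a = int j] (mod int q) \<or> [b - a = - int j] (mod int q))"
    using y(1)
  proof (cases rule: numbering_at)
    case (1 s)
    have "(b + s) - (a + s) = b - a" by simp
    then show ?thesis using y(2) ab unfolding 1 by metis
  next
    case (2 f)
    have "(f - a) - (f - b) = b - a" by simp
    then show ?thesis using y(2) ab unfolding 2 by (metis insert_commute)
  qed
  then obtain a b where d2: "snd d = {n a, n b}"
      and ab: "[b - a = int j] (mod int q) \<or> [b - a = - int j] (mod int q)"
    by blast
  from ab have "\<exists>i. d = c i"
  proof
    assume "[b - a = int j] (mod int q)"
    then have "[b = a + int j] (mod int q)"
      by (simp add: cong_iff_dvd_diff algebra_simps)
    then have "d = c a" using d2 d(2) n_cong by (simp add: numbered_corner_def prod_eq_iff)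
    then show ?thesis ..
  next
    assume "[b - a = - int j] (mod int q)"
    then have "[a = b + int j] (mod int q)"
      by (subst cong_sym_eq) (simp add: cong_iff_dvd_diff algebra_simps)
    then have "d = c b" using d2 d(2) n_cong by (auto simp add: numbered_corner_def prod_eq_iff)
    then show ?thesis ..
  qed
  then show ?thesis using that d(1) by (auto simp: S_def)
qed

lemma local_corneration_S: "local_corneration L v = c ` S"
proof
  show "local_corneration L v \<subseteq> c ` S"
    unfolding local_corneration_def using local_corner by blast
  show "c ` S \<subseteq> local_corneration L v"
    by (auto simp: local_corneration_def S_def numbered_corner_def)
qed

text \<open>The dart with label \<open>i + j\<close> can lie only in \<open>c i\<close>, as its
  second edge, or in \<open>c (i + j)\<close>, as its first.\<close>

lemma S_iff: "i \<in> S \<longleftrightarrow> i + int j \<notin> S"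
proof -
  have "n (i + int j) \<in> {e \<in> edges M. incident v e}"
    unfolding incident_n by simp
  then have "(v, n (i + int j)) \<in> darts M"
    using v_vertex by (simp add: darts_def)
  then have ex: "\<exists>!d. d \<in> L \<and> (v, n (i + int j)) \<in> corner_darts d"
    using L unfolding j_corneration_def corneration_def by blast
  then obtain d where d: "d \<in> L" "(v, n (i + int j)) \<in> corner_darts d" by blast
  then have "fst d = v" by (simp add: corner_darts_def)
  then obtain k where k: "k \<in> S" "d = c k" using local_corner d by blast
  have "[i + int j = k] (mod int q) \<or> [i + int j = k + int j] (mod int q)"
    using d(2) k(2) by (auto simp: corner_darts_def numbered_corner_def n_eq_iff)
  then have "i \<in> S \<or> i + int j \<in> S"
    using k(1) S_cong cong_add_rcancel by blast
  moreover have "\<not> (i \<in> S \<and> i + int j \<in> S)"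
  proof
    assume i: "i \<in> S \<and> i + int j \<in> S"
    have "(v, n (i + int j)) \<in> corner_darts (c i)" "(v, n (i + int j)) \<in> corner_darts (c (i + int j))"
      by (auto simp: corner_darts_def numbered_corner_def)
    then have "c i = c (i + int j)"
      using ex i unfolding S_def by blast
    then show False using c_eq_iff not_cong by simp
  qed
  ultimately show ?thesis by blast
qed

lemma H_D:
  assumes "g \<in> H"
  shows "g \<in> Aut_map M" "g ` v = v" "move_corner g ` L = L"
  using assms by (auto simp: H_def vertex_stabilizer_def Aut_corneration_def)

lemma H_compose:
  assumes "g \<in> H" "h \<in> H"
  shows "\<exists>k\<in>H. \<forall>i. k ` n i = g ` h ` n i"
proof
  have im: "compose (flags M) g h ` Y = g ` h ` Y" if "Y \<subseteq> flags M" for Y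
    using that by (force simp: compose_def image_iff)
  show "\<forall>i. compose (flags M) g h ` n i = g ` h ` n i"
    using im edge_of_subset by (simp add: n_fl)
  show "compose (flags M) g h \<in> H"
    using assms Aut_corneration_compose[OF _ _ L_corners] im[of v] v_flags
    by (auto simp: H_def vertex_stabilizer_def)
qed

lemma A_cong:
  assumes "[a = b] (mod int q)" "a \<in> A"
  shows "b \<in> A"
proof -
  have "n (i + a) = n (i + b)" for i
    using assms(1) by (intro n_cong) (simp add: cong_add)
  then show ?thesis using assms(2) by (simp add: A_def)
qed

lemma A_add:
  assumes "a \<in> A" "b \<in> A"
  shows "a + b \<in> A"
proof -
  obtain g h where gh: "g \<in> H" "h \<in> H" "\<forall>i. g ` n i = n (i + a)" "\<forall>i. h ` n i = n (i + b)"
    using assms by (auto simp: A_def)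
  then have "g ` h ` n i = n (i + (a + b))" for i
    by (simp add: add_ac)
  then show ?thesis using H_compose[OF gh(1,2)] by (auto simp: A_def)
qed

lemma A_uminus:
  assumes "a \<in> A"
  shows "- a \<in> A"
proof -
  have "a * int (Suc k) \<in> A" for k
  proof (induction k)
    case (Suc k)
    then show ?case using A_add[OF assms Suc] by (simp add: algebra_simps)
  qed (simp add: assms)
  \<comment> \<open>A sum of \<open>q - 1\<close> copies of \<open>a\<close> is congruent to
    \<open>- a\<close>, so no inverse symmetry has to be formed.\<close>
  then have "a * int (Suc (q - 2)) \<in> A" .
  also have "int (Suc (q - 2)) = int q - 1" using j by simp
  finally show ?thesis
    by (rule A_cong[rotated]) (simp add: cong_iff_dvd_diff algebra_simps)
qed

lemma B_diff:
  assumes "f \<in> B" "f' \<in> B"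
  shows "f - f' \<in> A"
proof -
  obtain g h where gh: "g \<in> H" "h \<in> H" "\<forall>i. g ` n i = n (f - i)" "\<forall>i. h ` n i = n (f' - i)"
    using assms by (auto simp: B_def)
  then have "g ` h ` n i = n (i + (f - f'))" for i
    by (simp add: algebra_simps)
  then show ?thesis using H_compose[OF gh(1,2)] by (auto simp: A_def)
qed

lemma A_B_add:
  assumes "a \<in> A" "f \<in> B"
  shows "a + f \<in> B"
proof -
  obtain g h where gh: "g \<in> H" "h \<in> H" "\<forall>i. g ` n i = n (i + a)" "\<forall>i. h ` n i = n (f - i)"
    using assms by (auto simp: A_def B_def)
  then have "g ` h ` n i = n (a + f - i)" for i
    by (simp add: algebra_simps)
  then show ?thesis using H_compose[OF gh(1,2)] by (auto simp: B_def)
qed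

lemma move_rotation:
  "g ` v = v \<Longrightarrow> (\<And>i. g ` n i = n (i + a)) \<Longrightarrow> move_corner g (c i) = c (i + a)"
  by (simp add: move_corner_def numbered_corner_def add_ac)

lemma move_reflection:
  "g ` v = v \<Longrightarrow> (\<And>i. g ` n i = n (f - i)) \<Longrightarrow> move_corner g (c i) = c (f - int j - i)"
  by (simp add: move_corner_def numbered_corner_def algebra_simps insert_commute)

lemma H_invariant: "g \<in> H \<Longrightarrow> d \<in> L \<Longrightarrow> move_corner g d \<in> L"
  using H_D(3) by blast

lemma S_A:
  assumes "i \<in> S" "a \<in> A"
  shows "i + a \<in> S"
proof -
  obtain g where g: "g \<in> H" "\<And>i. g ` n i = n (i + a)"
    using assms(2) by (auto simp: A_def)
  have "move_corner g (c i) = c (i + a)"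
    by (rule move_rotation[OF H_D(2)[OF g(1)] g(2)])
  then show ?thesis
    using H_invariant[OF g(1), of "c i"] assms(1) by (simp add: S_def)
qed

lemma S_B:
  assumes "i \<in> S" "f \<in> B"
  shows "f - int j - i \<in> S"
proof -
  obtain g where g: "g \<in> H" "\<And>i. g ` n i = n (f - i)"
    using assms(2) by (auto simp: B_def)
  have "move_corner g (c i) = c (f - int j - i)"
    by (rule move_reflection[OF H_D(2)[OF g(1)] g(2)])
  then show ?thesis
    using H_invariant[OF g(1), of "c i"] assms(1) by (simp add: S_def)
qed

text \<open>A corner determines its vertex, so a symmetry taking one corner at \<open>v\<close> to
  another fixes \<open>v\<close>. Thus transitivity on \<open>L\<close> restricts to the local
  action.\<close>

lemma S_transitive:
  assumes "i \<in> S" "k \<in> S"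
  shows "k - i \<in> A \<or> i + k + int j \<in> B"
proof -
  obtain g where g: "g \<in> Aut_corneration M L" "move_corner g (c i) = c k"
    using L_transitive assms by (auto simp: transitive_corneration_def S_def)
  have gv: "g ` v = v"
    using g(2) by (simp add: move_corner_def numbered_corner_def)
  have gH: "g \<in> H" using g(1) gv by (simp add: H_def vertex_stabilizer_def)
  from H_D(1,2)[OF gH] show ?thesis
  proof (cases rule: stabilizer_action)
    case (1 a)
    then have "a \<in> A" using gH by (auto simp: A_def)
    moreover have "[i + a = k] (mod int q)"
      using move_rotation[OF gv 1] g(2) c_eq_iff by metis
    then have "[a = k - i] (mod int q)" by (simp add: cong_iff_dvd_diff algebra_simps)
    ultimately show ?thesis using A_cong by blast
  next
    case (2 f)
    have "[f - int j - i = k] (mod int q)"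
      using move_reflection[OF gv 2] g(2) c_eq_iff by metis
    then have "[f - l = i + k + int j - l] (mod int q)" for l
      by (simp add: cong_iff_dvd_diff algebra_simps)
    then have "g ` n l = n (i + k + int j - l)" for l
      using 2 n_cong by metis
    then show ?thesis using gH by (auto simp: B_def)
  qed
qed

text \<open>Transitivity applied to a corner and itself gives the shift 0, directly or as the
  difference of a reflection value with itself.\<close>

lemma q_A: "int q \<in> A"
proof -
  obtain i where "i \<in> S" using S_iff by blast
  then have "i - i \<in> A"
    using S_transitive[of i i] B_diff[of "i + i + int j" "i + i + int j"] by auto
  then have "0 \<in> A" by simp
  then show ?thesis by (rule A_cong[rotated]) (simp add: cong_def)
qed

section \<open>Comparison with the standard forms\<close>

lemma numbered_corner_shift: "numbered_corner v (\<lambda>i. n (i + s)) j i = c (i + s)"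
  by (simp add: numbered_corner_def add_ac)

lemma standard_odd_local:
  assumes "odd j" "even q" "S = {i. even (i - s)}"
  shows "equiv_standard_odd M q j v (local_corneration L v)"
proof -
  obtain Q where Q: "q = 2 * Q" using assms(2) by (elim evenE)
  have "c ` S = standard_odd q j v (\<lambda>i. n (i + s))"
  proof
    show "c ` S \<subseteq> standard_odd q j v (\<lambda>i. n (i + s))"
    proof
      fix d assume "d \<in> c ` S"
      then obtain i where i: "even (i - s)" "d = c i" using assms(3) by auto
      then obtain m where m: "i = 2 * m + s" by (metis diff_add_cancel evenE)
      \<comment> \<open>Reducing \<open>m\<close> modulo half the valence changes
        \<open>2 * m\<close> by a multiple of \<open>q\<close> and brings the index into the range
        of \<open>standard_odd\<close>.\<close>
      have "[i = 2 * (m mod int Q) + s] (mod int q)"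
        unfolding m Q by (rule cong_add) (simp_all add: cong_def)
      then have "d = c (2 * (m mod int Q) + s)" using i(2) c_eq_iff by simp
      moreover have "m mod int Q \<in> {0..<int (q div 2)}" using Q j by simp
      ultimately show "d \<in> standard_odd q j v (\<lambda>i. n (i + s))"
        unfolding standard_odd_def numbered_corner_shift by blast
    qed
    show "standard_odd q j v (\<lambda>i. n (i + s)) \<subseteq> c ` S"
      unfolding standard_odd_def numbered_corner_shift assms(3) by auto
  qed
  then show ?thesis
    using assms(1,2) numbering_shift unfolding equiv_standard_odd_def local_corneration_S by blast
qed

lemma standard_even_local:
  assumes "j mod 4 = 2" "4 dvd q" "S = {i. (i - s) mod 4 \<in> {0, 3}}"
  shows "equiv_standard_even M q j v (local_corneration L v)"
proof -
  have "c ` S = standard_even q j v (\<lambda>i. n (i + s))"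
  proof
    show "c ` S \<subseteq> standard_even q j v (\<lambda>i. n (i + s))"
    proof
      fix d assume "d \<in> c ` S"
      then obtain i where "i \<in> S" "d = c i" by blast
      then have i: "(i - s) mod 4 \<in> {0, 3}" "d = c i" using assms(3) by blast+
      let ?i = "(i - s) mod int q"
      have "[?i + s = i - s + s] (mod int q)"
        by (rule cong_add) (simp_all add: cong_def)
      then have "d = c (?i + s)" using i(2) c_eq_iff[of "?i + s" i] by simp
      moreover have "?i \<in> {0..<int q}" using j by simp
      moreover have "?i mod 4 = (i - s) mod 4"
        using assms(2) by (metis int_dvd_int_iff mod_mod_cancel of_nat_numeral)
      ultimately show "d \<in> standard_even q j v (\<lambda>i. n (i + s))"
        using i(1) unfolding standard_even_def numbered_corner_shift by auto
    qed
    show "standard_even q j v (\<lambda>i. n (i + s)) \<subseteq> c ` S"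
      unfolding standard_even_def numbered_corner_shift assms(3) by auto
  qed
  then show ?thesis
    using assms(1,2) numbering_shift unfolding equiv_standard_even_def local_corneration_S by blast
qed

text \<open>Starting the numbering at \<open>s\<close> shifts both argument and result. This leaves
  rotations unchanged but lowers a reflection value by \<open>2 * s\<close>.\<close>

lemma label_action_H:
  "label_action q (\<lambda>i. n (i + s)) H = rho q ` A \<union> mu q ` {f. f + 2 * s \<in> B}"
proof
  have lab: "k = i mod int q" if "[k = i] (mod int q)" "k \<in> labels q" for i k
    using that by (simp add: labels_def cong_def)
  show "label_action q (\<lambda>i. n (i + s)) H \<subseteq> rho q ` A \<union> mu q ` {f. f + 2 * s \<in> B}"
  proof
    fix \<sigma> assume "\<sigma> \<in> label_action q (\<lambda>i. n (i + s)) H"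
    then obtain g where \<sigma>: "\<sigma> \<in> Bij (labels q)" and g: "g \<in> H"
        "\<And>i. i \<in> labels q \<Longrightarrow> g ` n (i + s) = n (\<sigma> i + s)"
      by (auto simp: label_action_def)
    have ext: "\<sigma> \<in> extensional (labels q)" and ran: "\<And>i. i \<in> labels q \<Longrightarrow> \<sigma> i \<in> labels q"
      using \<sigma> by (auto simp: Bij_def bij_betw_def)
    from H_D(1,2)[OF g(1)] show "\<sigma> \<in> rho q ` A \<union> mu q ` {f. f + 2 * s \<in> B}"
    proof (cases rule: stabilizer_action)
      case (1 a)
      have "\<sigma> i = (i + a) mod int q" if "i \<in> labels q" for i
      proof (rule lab[OF _ ran[OF that]])
        have "[\<sigma> i + s = i + s + a] (mod int q)" using g(2)[OF that] 1 n_eq_iff by metis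
        then show "[\<sigma> i = i + a] (mod int q)" by (simp add: cong_iff_dvd_diff algebra_simps)
      qed
      then have "\<sigma> = rho q a"
        using ext by (intro extensionalityI[of _ "labels q"]) (auto simp: rho_def)
      then show ?thesis using g(1) 1 by (auto simp: A_def)
    next
      case (2 f)
      have "\<sigma> i = (f - 2 * s - i) mod int q" if "i \<in> labels q" for i
      proof (rule lab[OF _ ran[OF that]])
        have "[\<sigma> i + s = f - (i + s)] (mod int q)" using g(2)[OF that] 2 n_eq_iff by metis
        then show "[\<sigma> i = f - 2 * s - i] (mod int q)" by (simp add: cong_iff_dvd_diff algebra_simps)
      qed
      then have "\<sigma> = mu q (f - 2 * s)"
        using ext by (intro extensionalityI[of _ "labels q"]) (auto simp: mu_def)
      moreover have "f \<in> B" using g(1) 2 by (auto simp: B_def)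
      ultimately show ?thesis by (intro UnI2 image_eqI[of _ _ "f - 2 * s"]) simp_all
    qed
  qed
  show "rho q ` A \<union> mu q ` {f. f + 2 * s \<in> B} \<subseteq> label_action q (\<lambda>i. n (i + s)) H"
  proof (intro Un_least subsetI)
    fix \<sigma> assume "\<sigma> \<in> rho q ` A"
    then obtain a g where g: "\<sigma> = rho q a" "g \<in> H" "\<And>i. g ` n i = n (i + a)"
      by (auto simp: A_def)
    have "g ` n (i + s) = n (rho q a i + s)" if "i \<in> labels q" for i
      using that unfolding g(3) by (intro n_cong) (simp add: rho_def cong_def mod_simps algebra_simps)
    then show "\<sigma> \<in> label_action q (\<lambda>i. n (i + s)) H"
      using g rho_Bij unfolding label_action_def by blast
  next
    fix \<sigma> assume "\<sigma> \<in> mu q ` {f. f + 2 * s \<in> B}"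
    then obtain f g where g: "\<sigma> = mu q f" "g \<in> H" "\<And>i. g ` n i = n (f + 2 * s - i)"
      by (auto simp: B_def)
    have "g ` n (i + s) = n (mu q f i + s)" if "i \<in> labels q" for i
      using that unfolding g(3) by (intro n_cong) (simp add: mu_def cong_def mod_simps algebra_simps)
    then show "\<sigma> \<in> label_action q (\<lambda>i. n (i + s)) H"
      using g mu_Bij unfolding label_action_def by blast
  qed
qed

lemma local_type:
  "(odd j \<and> equiv_standard_odd M q j v (local_corneration L v)) \<or>
   (j mod 4 = 2 \<and> equiv_standard_even M q j v (local_corneration L v) \<and>
     type_QD M q (Aut_corneration M L) v)"
proof -
  have q: "int q > 0" "q > 0" using j by simp_all
  have "(odd (int j) \<and> even (int q) \<and> (\<exists>s. S = {i. even (i - s)})) \<or>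
    (int j mod 4 = 2 \<and> 4 dvd int q \<and>
      (\<exists>s. S = {i. (i - s) mod 4 \<in> {0, 3}} \<and> A = {a. 4 dvd a} \<and> B = {f. (f - 2 * s) mod 4 = 1}))"
    by (rule local_corneration_cases[OF A_add A_uminus q_A q(1) B_diff A_B_add S_A S_B S_iff S_transitive])
  then show ?thesis
  proof (elim disjE conjE exE)
    fix s assume "odd (int j)" "even (int q)" "S = {i. even (i - s)}"
    then show ?thesis using standard_odd_local by simp
  next
    fix s assume s: "int j mod 4 = 2" "4 dvd int q" "S = {i. (i - s) mod 4 \<in> {0, 3}}"
      "A = {a. 4 dvd a}" "B = {f. (f - 2 * s) mod 4 = 1}"
    have j4: "j mod 4 = 2" using s(1) by presburger
    have q4: "4 dvd q" using s(2) by presburger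
    \<comment> \<open>The values in \<open>B\<close> are congruent to \<open>1 + 2 * s\<close>
      modulo 4; starting the numbering at \<open>s\<close> turns them into those congruent to
      1.\<close>
    have "label_action q (\<lambda>i. n (i + s)) H = generate (BijGroup (labels q)) {mu q 1, mu q 5}"
      unfolding label_action_H generate_mu[OF q4 q(2)] s(4,5) by simp
    then have "type_QD M q (Aut_corneration M L) v"
      using q4 numbering_shift unfolding type_QD_def H_def by blast
    then show ?thesis using standard_even_local[OF j4 q4 s(3)] j4 by blast
  qed
qed

end

theorem theorem6p3:
  fixes M :: "'f flag_system" and q j :: nat and L :: "'f corner set" and v :: "'f set"
  assumes "is_map M" and "has_valence M q"
    and "1 \<le> j" and "2 * j < q"
    and "j_corneration M q j L" and "transitive_corneration M L"
    and "v \<in> vertices M"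
  shows "(odd j \<and> equiv_standard_odd M q j v (local_corneration L v)) \<or>
         (j mod 4 = 2 \<and> equiv_standard_even M q j v (local_corneration L v) \<and>
          type_QD M q (Aut_corneration M L) v)"
proof -
  obtain x where x: "x \<in> flags M" and v: "v = vertex_of M x"
    using assms(7) by (auto simp: vertices_def)
  interpret vertex_corneration M q x j L
    by unfold_locales (use assms x in auto)
  show ?thesis using local_type v by simp
qed

end
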